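(* Let $\mathbb{H}$ be a real separable Hilbert space with unit sphere $\mathbb{S}$, let $X\sim P_X$ be a random element of $\mathbb{H}$ (with $P_X$ a Borel probability measure on $\mathbb{H}$), and let $u\in(0,1)$. Let $V\sim\nu$ be a random element of $\mathbb{S}$, independent of $X$, which is smooth in the sense that $\nu(H)=0$ (i.e. $\nu(H\cap\mathbb{S})=0$) for every hyperplane $H\subset\mathbb{H}$ passing through the origin. If $P_X$ has no atom with probability at least $1/2$, i.e. $$\sup_{x\in\mathbb{H}}P_X(\{x\})<\tfrac12,$$ then $\beta(u)>0$, where $\beta(u)=q_u[\mathsf{MAD}[\langle X,V\rangle]]$ is the $u$-quantile of the random variable $\omega\mapsto\mathsf{MAD}[\langle X,V(\omega)\rangle]$.
   Context: $\mathbb{H}$ has inner product $\langle\cdot,\cdot\rangle$ and induced norm $\|\cdot\|$; $\mathbb{S}=\{v\in\mathbb{H}:\|v\|=1\}$. A hyperplane in $\mathbb{H}$ is a set $\{x\in\mathbb{H}:\langle x,v\rangle=c\}$ with $v\in\mathbb{S}$, $c\in\mathbb{R}$. For a real random variable $U$, the median $\mathsf{med}[U]$ is the midpoint of the set of all $m\in\mathbb{R}$ with $\min\{\mathbb{P}(U\le m),\mathbb{P}(U\ge m)\}\ge 1/2$, and the median absolute deviation is $\mathsf{MAD}[U]=\mathsf{med}[|U-\mathsf{med}[U]|]$. For a non-negative real random variable $Z$ with distribution function $F$, the $u$-quantile is $q_u[Z]=\inf\{x\ge 0: F(x)\ge u\}$. In the definition of $\beta(u)$, $V$ is a random element supported on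 $\mathbb{S}$ (the support being the smallest closed set $A\subseteq\mathbb{H}$ with $\mathbb{P}(V\in A)=1$; thus the support of $V$ is $\mathbb{S}$). The quantity $\mathsf{MAD}[\langle X,V\rangle]$ is viewed as a random variable through the randomness of $V$ only: $\mathsf{MAD}[\langle X,V\rangle](\omega)=\mathsf{MAD}[\langle X,V(\omega)\rangle]$, where for fixed $v\in\mathbb{S}$, $\mathsf{MAD}[\langle X,v\rangle]$ is computed with respect to the law of $X$. *)

theory Defs
  imports "HOL-Probability.Probability"
begin

definition hyperplane :: "'a::real_inner set \<Rightarrow> bool" where
  "hyperplane H \<longleftrightarrow> (\<exists>v\<in>sphere 0 1. \<exists>c::real. H = {x. x \<bullet> v = c})"

definition has_support :: "'a::topological_space measure \<Rightarrow> 'a set \<Rightarrow> bool" where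
  "has_support N A \<longleftrightarrow>
     closed A \<and> measure N A = 1 \<and> (\<forall>B. closed B \<and> measure N B = 1 \<longrightarrow> A \<subseteq> B)"

definition medians :: "'b measure \<Rightarrow> ('b \<Rightarrow> real) \<Rightarrow> real set" where
  "medians M U = {m. min (\<P>(\<omega> in M. U \<omega> \<le> m)) (\<P>(\<omega> in M. U \<omega> \<ge> m)) \<ge> 1/2}"

text \<open>For a random variable \<open>U\<close> on a probability space, \<open>medians M U\<close> is a nonempty compact
  interval, so its infimum and supremum are its two endpoints.\<close>

definition med :: "'b measure \<Rightarrow> ('b \<Rightarrow> real) \<Rightarrow> real" where
  "med M U = midpoint (Inf (medians M U)) (Sup (medians M U))"

definition MAD :: "'b measure \<Rightarrow> ('b \<Rightarrow> real) \<Rightarrow> real" where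
  "MAD M U = med M (\<lambda>\<omega>. \<bar>U \<omega> - med M U\<bar>)"

definition quantile :: "real \<Rightarrow> 'b measure \<Rightarrow> ('b \<Rightarrow> real) \<Rightarrow> real" where
  "quantile u M Z = Inf {x. x \<ge> 0 \<and> cdf (distr M borel Z) x \<ge> u}"

text \<open>The inner \<open>MAD\<close> is taken on \<open>'a\<close> equipped with the law of \<open>X\<close>, for fixed \<open>V \<omega>\<close>; only the
  outer quantile uses the randomness of \<open>V\<close>.\<close>

definition beta_quantile ::
  "real \<Rightarrow> 'b measure \<Rightarrow> ('b \<Rightarrow> 'a::{real_inner, polish_space}) \<Rightarrow> ('b \<Rightarrow> 'a) \<Rightarrow> real" where
  "beta_quantile u M X V = quantile u M (\<lambda>\<omega>. MAD (distr M borel X) (\<lambda>x. x \<bullet> V \<omega>))"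

end

theory Submission
  imports Defs
begin

text \<open>The median absolute deviation of \<open>U\<close> vanishes only if \<open>U\<close> has an atom of mass at least
  \<open>1/2\<close>. For distinct \<open>x\<close> and \<open>y\<close> the vectors orthogonal to \<open>x - y\<close> form a hyperplane through
  the origin, so Fubini shows that for almost every direction \<open>v\<close> two independent copies of \<open>X\<close>
  have the same inner product with \<open>v\<close> only when they coincide. For such \<open>v\<close> an atom of
  \<open>\<langle>X, v\<rangle>\<close> comes from a single atom of \<open>X\<close> of the same mass, which is less than \<open>1/2\<close>. Hence
  \<open>MAD \<langle>X, V\<rangle>\<close> is almost surely positive, and right-continuity of its distribution function at
  \<open>0\<close> makes every quantile of positive level positive.\<close>

text \<open>The threshold is the pseudoinverse of the distribution function at \<open>p\<close>.
  Right-continuity makes its infimum attained, so the equivalence also holds at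
  \<open>m = a\<close>.\<close>

lemma (in prob_space) lower_quantile_threshold:
  fixes U :: "'a \<Rightarrow> real"
  assumes [measurable]: "U \<in> borel_measurable M" and p: "0 < p" "p < 1"
  obtains a where "\<And>m. p \<le> \<P>(\<omega> in M. U \<omega> \<le> m) \<longleftrightarrow> a \<le> m"
proof -
  interpret D: real_distribution "distr M borel U"
    by (rule real_distribution_distr) simp
  interpret C: cdf_distribution "distr M borel U"
    by unfold_locales
  have "p \<le> \<P>(\<omega> in M. U \<omega> \<le> m) \<longleftrightarrow> C.I p \<le> m" for m
  proof -
    have "cdf (distr M borel U) m = \<P>(\<omega> in M. U \<omega> \<le> m)"
      by (simp add: cdf_def measure_distr vimage_def Int_def conj_commute)
    with C.pseudoinverse[of p m] p show ?thesis by simp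
  qed
  then show thesis by (rule that)
qed

text \<open>Each endpoint is a quantile threshold at level \<open>1/2\<close>, the upper one being
  obtained from \<open>- U\<close>. They come in the right order because a point strictly between
  reversed endpoints would have both tails below \<open>1/2\<close>, while the two tails cover the
  space.\<close>

lemma (in prob_space) medians_interval:
  fixes U :: "'a \<Rightarrow> real"
  assumes [measurable]: "U \<in> borel_measurable M"
  obtains a b where "a \<le> b" "medians M U = {a..b}"
    "\<And>m. 1/2 \<le> \<P>(\<omega> in M. U \<omega> \<le> m) \<longleftrightarrow> a \<le> m"
    "\<And>m. 1/2 \<le> \<P>(\<omega> in M. U \<omega> \<ge> m) \<longleftrightarrow> m \<le> b"
proof -
  obtain a where a: "\<And>m. 1/2 \<le> \<P>(\<omega> in M. U \<omega> \<le> m) \<longleftrightarrow> a \<le> m"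
    by (rule lower_quantile_threshold[of U "1/2"]) auto
  obtain b where b: "\<And>m. 1/2 \<le> \<P>(\<omega> in M. - U \<omega> \<le> m) \<longleftrightarrow> b \<le> m"
    by (rule lower_quantile_threshold[of "\<lambda>\<omega>. - U \<omega>" "1/2"]) auto
  have b': "1/2 \<le> \<P>(\<omega> in M. U \<omega> \<ge> m) \<longleftrightarrow> m \<le> - b" for m
    using b[of "- m"] by (simp add: le_minus_iff)
  have "a \<le> - b"
  proof (rule ccontr)
    assume "\<not> a \<le> - b"
    then obtain m where "- b < m" "m < a" using dense[of "- b" a] by auto
    with a[of m] b'[of m]
    have "\<P>(\<omega> in M. U \<omega> \<le> m) < 1/2" "\<P>(\<omega> in M. U \<omega> \<ge> m) < 1/2" by auto
    moreover have "1 \<le> \<P>(\<omega> in M. U \<omega> \<le> m) + \<P>(\<omega> in M. U \<omega> \<ge> m)"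
    proof -
      have "space M = {\<omega> \<in> space M. U \<omega> \<le> m} \<union> {\<omega> \<in> space M. U \<omega> \<ge> m}" by auto
      then show ?thesis
        using measure_Un_le[of "{\<omega> \<in> space M. U \<omega> \<le> m}" M "{\<omega> \<in> space M. U \<omega> \<ge> m}"]
        by (simp add: prob_space)
    qed
    ultimately show False by linarith
  qed
  moreover have "medians M U = {a..- b}"
    unfolding medians_def min.bounded_iff a b' by auto
  ultimately show thesis using a b' by (rule that)
qed

text \<open>This serves to make \<open>MAD\<close> a random variable in the direction. Level sets of
  the endpoints are conditions on probabilities of sections, which depend measurably on the
  parameter.\<close>

lemma (in prob_space) borel_measurable_med:
  fixes f :: "'b \<Rightarrow> 'a \<Rightarrow> real"
  assumes [measurable]: "case_prod f \<in> borel_measurable (N \<Otimes>\<^sub>M M)"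
  shows "(\<lambda>y. med M (f y)) \<in> borel_measurable N"
proof -
  have f: "f y \<in> borel_measurable M" if "y \<in> space N" for y
    using that by measurable
  have Inf: "(\<lambda>y. Inf (medians M (f y))) \<in> borel_measurable N"
  proof (rule borel_measurableI_le)
    fix t
    have "Inf (medians M (f y)) \<le> t \<longleftrightarrow> 1/2 \<le> \<P>(x in M. f y x \<le> t)" if "y \<in> space N" for y
      by (rule medians_interval[OF f[OF that]]) simp
    then have "{y \<in> space N. Inf (medians M (f y)) \<le> t}
        = {y \<in> space N. 1/2 \<le> \<P>(x in M. f y x \<le> t)}" by auto
    also have "\<dots> \<in> sets N" by measurable
    finally show "{y \<in> space N. Inf (medians M (f y)) \<le> t} \<in> sets N" .
  qed
  have Sup: "(\<lambda>y. Sup (medians M (f y))) \<in> borel_measurable N"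
  proof (rule borel_measurableI_ge)
    fix t
    have "t \<le> Sup (medians M (f y)) \<longleftrightarrow> 1/2 \<le> \<P>(x in M. f y x \<ge> t)" if "y \<in> space N" for y
      by (rule medians_interval[OF f[OF that]]) simp
    then have "{y \<in> space N. t \<le> Sup (medians M (f y))}
        = {y \<in> space N. 1/2 \<le> \<P>(x in M. f y x \<ge> t)}" by auto
    also have "\<dots> \<in> sets N" by measurable
    finally show "{y \<in> space N. t \<le> Sup (medians M (f y))} \<in> sets N" .
  qed
  show ?thesis
    unfolding med_def midpoint_def using Inf Sup by measurable
qed

lemma (in prob_space) borel_measurable_MAD:
  fixes f :: "'b \<Rightarrow> 'a \<Rightarrow> real"
  assumes [measurable]: "case_prod f \<in> borel_measurable (N \<Otimes>\<^sub>M M)"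
  shows "(\<lambda>y. MAD M (f y)) \<in> borel_measurable N"
proof -
  have [measurable]: "(\<lambda>y. med M (f y)) \<in> borel_measurable N"
    by (rule borel_measurable_med) simp
  show ?thesis
    unfolding MAD_def by (rule borel_measurable_med) measurable
qed

lemma (in prob_space) MAD_pos:
  fixes U :: "'a \<Rightarrow> real"
  assumes [measurable]: "U \<in> borel_measurable M"
    and atom: "\<And>c. \<P>(\<omega> in M. U \<omega> = c) < 1/2"
  shows "0 < MAD M U"
proof -
  let ?W = "\<lambda>\<omega>. \<bar>U \<omega> - med M U\<bar>"
  obtain a b where ab: "a \<le> b" "medians M ?W = {a..b}"
    "\<And>m. 1/2 \<le> \<P>(\<omega> in M. ?W \<omega> \<le> m) \<longleftrightarrow> a \<le> m"
    by (rule medians_interval[of ?W]) auto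
  have "0 < a"
  proof (rule ccontr)
    assume "\<not> 0 < a"
    \<comment> \<open>A deviation at most \<open>0\<close> means that \<open>U\<close> equals its
      median, so this would be an atom of mass at least \<open>1/2\<close>.\<close>
    then have "1/2 \<le> \<P>(\<omega> in M. ?W \<omega> \<le> 0)" using ab(3)[of 0] by simp
    with atom[of "med M U"] show False by simp
  qed
  with ab show ?thesis by (simp add: MAD_def med_def midpoint_def)
qed

lemma (in prob_space) quantile_pos:
  fixes Z :: "'a \<Rightarrow> real"
  assumes [measurable]: "Z \<in> borel_measurable M" and u: "0 < u" "u < 1"
    and pos: "AE \<omega> in M. 0 < Z \<omega>"
  shows "0 < quantile u M Z"
proof -
  obtain a where a: "\<And>m. u \<le> \<P>(\<omega> in M. Z \<omega> \<le> m) \<longleftrightarrow> a \<le> m"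
    using lower_quantile_threshold[of Z u] u by auto
  have "\<P>(\<omega> in M. Z \<omega> \<le> 0) = 0"
    using pos by (subst prob_eq_0) auto
  with a[of 0] u have "0 < a" by auto
  have "cdf (distr M borel Z) m = \<P>(\<omega> in M. Z \<omega> \<le> m)" for m
    by (simp add: cdf_def measure_distr vimage_def Int_def conj_commute)
  \<comment> \<open>Since \<open>a\<close> is positive, the constraint \<open>x \<ge> 0\<close> cuts
    nothing off and the infimum is \<open>a\<close> itself.\<close>
  then have "{x. x \<ge> 0 \<and> cdf (distr M borel Z) x \<ge> u} = {a..}"
    using a \<open>0 < a\<close> by auto
  with \<open>0 < a\<close> show ?thesis by (simp add: quantile_def)
qed

text \<open>As \<open>H\<close> is not null, some \<open>x\<close> in \<open>H\<close> satisfies the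
  inner almost-everywhere statement. Then \<open>H\<close> lies in \<open>{x}\<close> up to a null
  set.\<close>

lemma (in prob_space) exists_atom_of_AE_pair_eq:
  assumes sing: "\<And>x. {x} \<in> sets M" and H: "H \<in> sets M" "0 < prob H"
    and eq: "AE x in M. AE y in M. x \<in> H \<longrightarrow> y \<in> H \<longrightarrow> x = y"
  obtains x where "prob H \<le> prob {x}"
proof -
  have "\<not> (AE x in M. x \<notin> H)"
    using H prob_eq_0[of H] by auto
  then obtain x where x: "x \<in> H" "AE y in M. y \<in> H \<longrightarrow> x = y"
    using eq by (metis (mono_tags, lifting) AE_mp AE_I2)
  have "prob H \<le> prob {x}"
    using x(2) sing by (intro finite_measure_mono_AE) auto
  then show thesis by (rule that)
qed

text \<open>For a fixed pair of distinct points the exceptional \<open>v\<close> are orthogonal to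
  their difference, a null set for \<open>N\<close>. Fubini then exchanges the pair with
  \<open>v\<close>.\<close>

lemma AE_inner_eq_imp_eq:
  fixes P N :: "'a::{real_inner, second_countable_topology} measure"
  assumes "prob_space P" "prob_space N"
    and [measurable_cong]: "sets P = sets borel" "sets N = sets borel"
    and hyp: "\<And>w. w \<noteq> 0 \<Longrightarrow> AE v in N. v \<bullet> w \<noteq> 0"
  shows "AE v in N. AE x in P. AE y in P. x \<bullet> v = y \<bullet> v \<longrightarrow> x = y"
proof -
  interpret P: prob_space P by fact
  interpret N: prob_space N by fact
  interpret PP: pair_prob_space P P ..
  interpret NPP: pair_prob_space N "P \<Otimes>\<^sub>M P" ..
  let ?Q = "\<lambda>v z. fst z \<bullet> v = snd z \<bullet> v \<longrightarrow> fst z = (snd z :: 'a)"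
  have m: "Measurable.pred (N \<Otimes>\<^sub>M (P \<Otimes>\<^sub>M P)) (\<lambda>(v, z). ?Q v z)"
    by measurable
  have "AE v in N. ?Q v z" for z
  proof (cases "fst z = snd z")
    case False
    from hyp[of "fst z - snd z"] False have "AE v in N. v \<bullet> (fst z - snd z) \<noteq> 0" by simp
    then show ?thesis
      by eventually_elim (simp add: inner_diff_right inner_commute)
  qed simp
  then have "AE z in P \<Otimes>\<^sub>M P. AE v in N. ?Q v z" by simp
  then have "AE v in N. AE z in P \<Otimes>\<^sub>M P. ?Q v z"
    using NPP.AE_commute[of ?Q] m by (simp add: pred_def split_beta')
  then show ?thesis
    by eventually_elim (auto dest: PP.AE_pair)
qed

theorem lemma1:
  fixes M :: "'b measure"
    and X V :: "'b \<Rightarrow> 'a::{real_inner, polish_space}"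
    and P\<^sub>X \<nu> :: "'a measure"
    and u :: real
  assumes "prob_space M"
    and "0 < u" and "u < 1"
    and "X \<in> borel_measurable M" and "distr M borel X = P\<^sub>X"
    and "V \<in> borel_measurable M" and "distr M borel V = \<nu>"
    and "\<forall>\<omega>\<in>space M. V \<omega> \<in> sphere 0 1"
    and "has_support \<nu> (sphere 0 1)"
    and "prob_space.indep_var M borel X borel V"
    and "\<forall>H. hyperplane H \<and> 0 \<in> H \<longrightarrow> measure \<nu> H = 0"
    and "(SUP x. measure P\<^sub>X {x}) < 1/2"
  shows "beta_quantile u M X V > 0"
proof -
  interpret M: prob_space M by fact
  note [measurable] = \<open>X \<in> borel_measurable M\<close> \<open>V \<in> borel_measurable M\<close>
  have P: "P\<^sub>X = distr M borel X" and N: "\<nu> = distr M borel V" using assms by auto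
  interpret P: prob_space P\<^sub>X unfolding P by (rule M.prob_space_distr) simp
  interpret N: prob_space \<nu> unfolding N by (rule M.prob_space_distr) simp
  have sets [measurable_cong]: "sets P\<^sub>X = sets borel" "sets \<nu> = sets borel"
    by (simp_all add: P N)
  have atom: "P.prob {x} < 1/2" for x
  proof -
    have "P.prob {x} \<le> (SUP x. P.prob {x})"
      \<comment> \<open>A real supremum bounds its family only if the family is bounded above;
        probabilities are bounded by \<open>1\<close>.\<close>
      by (rule cSUP_upper) (auto intro!: bdd_aboveI[of _ 1])
    with assms show ?thesis by simp
  qed
  have "AE v in \<nu>. v \<bullet> w \<noteq> 0" if "w \<noteq> 0" for w
  proof -
    have "hyperplane {v. v \<bullet> w = 0}"
      unfolding hyperplane_def using that
      \<comment> \<open>A hyperplane requires a unit normal, so \<open>w\<close> is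
        normalized.\<close>
      by (intro bexI[of _ "w /\<^sub>R norm w"] exI[of _ 0]) auto
    with assms have "N.prob {v. v \<bullet> w = 0} = 0" by simp
    moreover have "{v. v \<bullet> w = 0} \<in> sets \<nu>"
      unfolding sets by measurable
    ultimately have "AE v in \<nu>. v \<notin> {v. v \<bullet> w = 0}" by (subst N.prob_eq_0[symmetric])
    then show ?thesis by simp
  qed
  then have "AE v in \<nu>. AE x in P\<^sub>X. AE y in P\<^sub>X. x \<bullet> v = y \<bullet> v \<longrightarrow> x = y"
    by (intro AE_inner_eq_imp_eq sets) unfold_locales
  then have "AE v in \<nu>. 0 < MAD P\<^sub>X (\<lambda>x. x \<bullet> v)"
  proof eventually_elim
    case (elim v)
    show ?case
    proof (rule P.MAD_pos)
      fix c
      let ?H = "{x \<in> space P\<^sub>X. x \<bullet> v = c}"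
      show "P.prob ?H < 1/2"
      proof (rule ccontr)
        assume H: "\<not> P.prob ?H < 1/2"
        obtain x where "P.prob ?H \<le> P.prob {x}"
        proof (rule P.exists_atom_of_AE_pair_eq)
          \<comment> \<open>Any two points of \<open>?H\<close> share the inner product
            \<open>c\<close> with \<open>v\<close>.\<close>
          show "AE x in P\<^sub>X. AE y in P\<^sub>X. x \<in> ?H \<longrightarrow> y \<in> ?H \<longrightarrow> x = y"
            using elim by (auto elim!: eventually_mono)
        qed (use H sets in auto)
        with atom[of x] H show False by simp
      qed
    qed simp
  qed
  then have "AE \<omega> in M. 0 < MAD P\<^sub>X (\<lambda>x. x \<bullet> V \<omega>)"
    unfolding N by (rule AE_distrD[rotated]) simp
  moreover have "(\<lambda>\<omega>. MAD P\<^sub>X (\<lambda>x. x \<bullet> V \<omega>)) \<in> borel_measurable M"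
    by (rule P.borel_measurable_MAD) measurable
  ultimately show ?thesis
    unfolding beta_quantile_def P[symmetric]
    using \<open>0 < u\<close> \<open>u < 1\<close> by (intro M.quantile_pos)
qed

end
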